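(* Let $k=2$. Let $X$ be a random variable with values in a measurable space $(S,\Sigma)$ and $Y$ a random variable with values in $\{1,2\}$, both on the same probability space, and suppose that the setting is "pure": there are nonnegative real numbers $a_1,a_2$ with $a_1+a_2=1$ such that for each $x\in S$ the pair $(\rho_1(x),\rho_2(x))$ is a permutation of $(a_1,a_2)$. Then $$U(\Delta)=L(\Delta)=L_{\mathrm{FM}}(H)=p_*.$$ Moreover, $$U_{\mathrm{FM}}(H)>U_{\mathrm{simpl}}(\Delta)>p_*$$ unless there is a set $S_0\in\Sigma$ such that $\mu(S_0)=0$ and for each $x\in S\setminus S_0$ either $\rho_1(x)=\rho_2(x)=1/2$ or $\{\rho_1(x),\rho_2(x)\}=\{0,1\}$.
   Context: Let $\mathsf P$ be the underlying probability measure; here $k=2$ and $[k]=\{1,2\}$. For $y\in[k]$, $\mu_y(B):=\mathsf P(Y=y,\,X\in B)$ for $B\in\Sigma$; $\mu:=\mu_1+\mu_2$ is the distribution of $X$; $\rho_y:=\frac{d\mu_y}{d\mu}$ is the density of $\mu_y$ with respect to $\mu$. A classifier is a measurable function $f\colon S\to[k]$; its misclassification probability is $p_f:=\mathsf P(f(X)\ne Y)$. Let $f_*(x)$ be the smallest maximizer of $\rho_y(x)$ in $y\in[k]$. Then $p_*:=p_{f_*}=1-\int_S\max_{y\in[k]}\rho_y(x)\,\mu(dx)$, and $p_*$ is the smallest value of $p_f$ over all classifiers $f$. $\Delta:=\sum_{1\le y<z\le k}\|\mu_y-\mu_z\|=\sum_{1\le y<z\le k}\int_S|\rho_y-\rho_z|\,d\mu$,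 where $\|\cdot\|$ is the total variation norm (no factor $1/2$); so for $k=2$, $\Delta=\int_S|\rho_1-\rho_2|\,d\mu\in[0,1]$. $$L(\Delta):=1-\frac{1+\Delta}{k},\quad U(\Delta):=1-\frac{k+1+\Delta-2\lceil\Delta\rceil}{(k-\lceil\Delta\rceil)(k+1-\lceil\Delta\rceil)},\quad U_{\mathrm{simpl}}(\Delta):=1-\frac1{k-\Delta},$$ where $\lceil u\rceil$ is the smallest integer that is no less than $u$. $H:=H(Y|X):=-\int_S\mu(dx)\sum_{y=1}^k\rho_y(x)\ln\rho_y(x)$ is the conditional entropy (natural logarithms, $0\ln0:=0$); it takes values in $[0,\ln k]$. $L_{\mathrm{FM}}(H):=\Phi^{-1}(H)$, where $\Phi(p):=p\ln(k-1)+h_2(p)$, $h_2(p):=-p\ln p-(1-p)\ln(1-p)$ for $p\in(0,1)$, $h_2(0):=h_2(1):=0$; $\Phi$ is continuous and strictly increasing from $0$ to $\ln k$ on $[0,1-\frac1k]$, and $\Phi^{-1}\colon[0,\ln k]\to[0,1-\frac1k]$ is the inverse of this restriction. $$U_{\mathrm{FM}}(H):=\frac{e(H)-1}{e(H)}+\frac{1}{e(H)\,(e(H)+1)}\,\frac{H-\ln e(H)}{\ln(1+1/e(H))},\qquad e(H):=\lceil e^H\rceil-1$$ (for $H>0$). *)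

theory Defs
  imports "HOL-Probability.Probability" "HOL-Combinatorics.Permutations"
begin

section \<open>The measures \<open>\<mu>\<^sub>y\<close> and their densities\<close>

text \<open>
  Throughout, \<open>P\<close> is the underlying probability space, \<open>S\<close> is the measurable space in which \<open>X\<close>
  takes its values, and \<open>Y\<close> takes values in \<open>{1..k}\<close>.  The distribution \<open>\<mu>\<close> of \<open>X\<close> is \<open>distr P S X\<close>.
\<close>

definition class_measure ::
  "'a measure \<Rightarrow> 'b measure \<Rightarrow> ('a \<Rightarrow> 'b) \<Rightarrow> ('a \<Rightarrow> nat) \<Rightarrow> nat \<Rightarrow> 'b measure" where
  "class_measure P S X Y y = distr (restrict_space P {\<omega> \<in> space P. Y \<omega> = y}) S X"

lemma emeasure_class_measure:
  assumes X: "X \<in> P \<rightarrow>\<^sub>M S" and Y: "Y \<in> P \<rightarrow>\<^sub>M count_space {1..k}" and B: "B \<in> sets S"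
  shows "emeasure (class_measure P S X Y y) B = emeasure P {\<omega> \<in> space P. Y \<omega> = y \<and> X \<omega> \<in> B}"
proof -
  let ?A = "{\<omega> \<in> space P. Y \<omega> = y}"
  have "Y -` ({y} \<inter> {1..k}) \<inter> space P \<in> sets P"
    by (rule measurable_sets[OF Y]) simp
  also have "Y -` ({y} \<inter> {1..k}) \<inter> space P = ?A"
    using measurable_space[OF Y] by auto
  finally have A: "?A \<in> sets P" .
  have "emeasure (class_measure P S X Y y) B
      = emeasure (restrict_space P ?A) (X -` B \<inter> (?A \<inter> space P))"
    unfolding class_measure_def using X B
    by (subst emeasure_distr) (auto simp: space_restrict_space intro: measurable_restrict_space1)
  also have "\<dots> = emeasure P (X -` B \<inter> (?A \<inter> space P))"
    using A by (intro emeasure_restrict_space) auto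
  also have "X -` B \<inter> (?A \<inter> space P) = {\<omega> \<in> space P. Y \<omega> = y \<and> X \<omega> \<in> B}"
    by auto
  finally show ?thesis .
qed

lemma emeasure_distr_eq_sum_class_measure:
  assumes X: "X \<in> P \<rightarrow>\<^sub>M S" and Y: "Y \<in> P \<rightarrow>\<^sub>M count_space {1..k}" and B: "B \<in> sets S"
  shows "emeasure (distr P S X) B = (\<Sum>y\<in>{1..k}. emeasure (class_measure P S X Y y) B)"
proof -
  let ?C = "\<lambda>y. {\<omega> \<in> space P. Y \<omega> = y \<and> X \<omega> \<in> B}"
  have C: "?C y \<in> sets P" for y
  proof -
    have "(Y -` ({y} \<inter> {1..k}) \<inter> space P) \<inter> (X -` B \<inter> space P) \<in> sets P"
      by (rule sets.Int[OF measurable_sets[OF Y] measurable_sets[OF X B]]) simp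
    also have "(Y -` ({y} \<inter> {1..k}) \<inter> space P) \<inter> (X -` B \<inter> space P) = ?C y"
      using measurable_space[OF Y] by auto
    finally show ?thesis .
  qed
  have "(\<Sum>y\<in>{1..k}. emeasure (class_measure P S X Y y) B) = (\<Sum>y\<in>{1..k}. emeasure P (?C y))"
    using emeasure_class_measure[OF X Y B] by simp
  also have "\<dots> = emeasure P (\<Union>y\<in>{1..k}. ?C y)"
    using C by (intro sum_emeasure) (auto simp: disjoint_family_on_def)
  also have "(\<Union>y\<in>{1..k}. ?C y) = X -` B \<inter> space P"
    using measurable_space[OF Y] by fastforce
  finally show ?thesis
    using X B by (simp add: emeasure_distr)
qed

text \<open>
  Densities are determined only up to \<open>\<mu>\<close>-null sets, so \<open>\<rho>\<close> is an arbitrary choice of finite,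
  nonnegative versions rather than the version that \<^const>\<open>RN_deriv\<close> happens to select.
\<close>

definition class_densities ::
  "nat \<Rightarrow> 'a measure \<Rightarrow> 'b measure \<Rightarrow> ('a \<Rightarrow> 'b) \<Rightarrow> ('a \<Rightarrow> nat) \<Rightarrow> (nat \<Rightarrow> 'b \<Rightarrow> real) \<Rightarrow> bool" where
  "class_densities k P S X Y \<rho> \<longleftrightarrow>
    (\<forall>y\<in>{1..k}. \<rho> y \<in> borel_measurable S \<and> (\<forall>x\<in>space S. 0 \<le> \<rho> y x) \<and>
       class_measure P S X Y y = density (distr P S X) (\<lambda>x. ennreal (\<rho> y x)))"

definition pure_setting :: "nat \<Rightarrow> 'b measure \<Rightarrow> (nat \<Rightarrow> 'b \<Rightarrow> real) \<Rightarrow> bool" where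
  "pure_setting k S \<rho> \<longleftrightarrow>
    (\<exists>a :: nat \<Rightarrow> real. (\<forall>y\<in>{1..k}. 0 \<le> a y) \<and> (\<Sum>y\<in>{1..k}. a y) = 1 \<and>
       (\<forall>x\<in>space S. \<exists>\<pi>. \<pi> permutes {1..k} \<and> (\<forall>y\<in>{1..k}. \<rho> y x = a (\<pi> y))))"


section \<open>Misclassification probabilities\<close>

definition misclass_prob ::
  "'a measure \<Rightarrow> ('a \<Rightarrow> 'b) \<Rightarrow> ('a \<Rightarrow> nat) \<Rightarrow> ('b \<Rightarrow> nat) \<Rightarrow> real" where
  "misclass_prob P X Y f = measure P {\<omega> \<in> space P. f (X \<omega>) \<noteq> Y \<omega>}"

definition f_star :: "nat \<Rightarrow> (nat \<Rightarrow> 'b \<Rightarrow> real) \<Rightarrow> 'b \<Rightarrow> nat" where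
  "f_star k \<rho> x = (LEAST y. y \<in> {1..k} \<and> (\<forall>z\<in>{1..k}. \<rho> z x \<le> \<rho> y x))"

definition p_star ::
  "nat \<Rightarrow> 'a measure \<Rightarrow> ('a \<Rightarrow> 'b) \<Rightarrow> ('a \<Rightarrow> nat) \<Rightarrow> (nat \<Rightarrow> 'b \<Rightarrow> real) \<Rightarrow> real" where
  "p_star k P X Y \<rho> = misclass_prob P X Y (f_star k \<rho>)"


section \<open>Total variation and the bounds in terms of \<open>\<Delta>\<close>\<close>

text \<open>
  The total variation norm of the signed measure \<open>\<mu> - \<nu>\<close>, for finite measures \<open>\<mu>\<close>, \<open>\<nu>\<close> on the same
  \<open>\<sigma>\<close>-algebra, without a factor \<open>1/2\<close>.
\<close>

definition tv_norm_diff :: "'b measure \<Rightarrow> 'b measure \<Rightarrow> real" where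
  "tv_norm_diff \<mu> \<nu> =
    (\<Squnion>\<A>\<in>{\<A>. finite \<A> \<and> partition_on (space \<mu>) \<A> \<and> \<A> \<subseteq> sets \<mu>}.
       \<Sum>A\<in>\<A>. \<bar>measure \<mu> A - measure \<nu> A\<bar>)"

lemma tv_norm_diff_density:
  fixes f g :: "'b \<Rightarrow> real"
  assumes f: "integrable M f" and g: "integrable M g"
    and f0: "\<And>x. x \<in> space M \<Longrightarrow> 0 \<le> f x" and g0: "\<And>x. x \<in> space M \<Longrightarrow> 0 \<le> g x"
  shows "tv_norm_diff (density M f) (density M g) = (\<integral>x. \<bar>f x - g x\<bar> \<partial>M)"
proof -
  let ?I = "\<integral>x. \<bar>f x - g x\<bar> \<partial>M"
  let ?PP = "{\<A>. finite \<A> \<and> partition_on (space M) \<A> \<and> \<A> \<subseteq> sets M}"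
  have meas: "measure (density M h) A = (LINT x:A|M. h x)"
    if h: "integrable M h" "\<And>x. x \<in> space M \<Longrightarrow> 0 \<le> h x" and A: "A \<in> sets M"
    for h :: "'b \<Rightarrow> real" and A
  proof -
    have "emeasure (density M h) A = (\<integral>\<^sup>+x. ennreal (h x) * indicator A x \<partial>M)"
      using h A by (intro emeasure_density) auto
    also have "\<dots> = (\<integral>\<^sup>+x. ennreal (indicator A x * h x) \<partial>M)"
      by (intro nn_integral_cong) (auto simp: indicator_def)
    also have "\<dots> = ennreal (LINT x|M. indicator A x * h x)"
      using h integrable_mult_indicator[OF A h(1)]
      by (intro nn_integral_eq_integral AE_I2) (auto simp: indicator_def)
    finally show ?thesis
      using h by (auto simp: measure_def set_lebesgue_integral_def indicator_def
          intro!: enn2real_ennreal Bochner_Integration.integral_nonneg)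
  qed
  have si: "set_integrable M A h" if "integrable M h" "A \<in> sets M" for h :: "'b \<Rightarrow> real" and A
    unfolding set_integrable_def using that by (intro integrable_mult_indicator)
  have diff: "measure (density M f) A - measure (density M g) A = (LINT x:A|M. f x - g x)"
    if "A \<in> sets M" for A
    using that f g f0 g0 by (simp add: meas set_integral_diff si)
  let ?h = "\<lambda>x. f x - g x"
  have h: "integrable M ?h" "integrable M (\<lambda>x. \<bar>?h x\<bar>)"
    using f g by auto
  have parts: "(\<Sum>A\<in>\<A>. LINT x:A|M. \<bar>?h x\<bar>) = ?I" if "\<A> \<in> ?PP" for \<A>
  proof -
    have "(\<Sum>A\<in>\<A>. LINT x:A|M. \<bar>?h x\<bar>) = (LINT x:(\<Union>A\<in>\<A>. A)|M. \<bar>?h x\<bar>)"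
      using that h by (intro set_integral_finite_Union[symmetric] si)
        (auto simp: partition_on_def disjoint_family_on_def disjoint_def)
    also have "(\<Union>A\<in>\<A>. A) = space M"
      using that by (auto simp: partition_on_def)
    finally show ?thesis
      by (simp add: set_integral_space h)
  qed
  have upper: "(\<Sum>A\<in>\<A>. \<bar>measure (density M f) A - measure (density M g) A\<bar>) \<le> ?I"
    if "\<A> \<in> ?PP" for \<A>
  proof -
    have "\<bar>measure (density M f) A - measure (density M g) A\<bar> \<le> (LINT x:A|M. \<bar>?h x\<bar>)"
      if A: "A \<in> sets M" for A
      using set_integral_norm_bound[OF si[OF h(1) A]] by (simp add: diff[OF A])
    then show ?thesis
      unfolding parts[OF that, symmetric] using that by (intro sum_mono) blast
  qed
  define B where "B = {x \<in> space M. g x \<le> f x}"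
  have B: "B \<in> sets M" "space M - B \<in> sets M"
    unfolding B_def using f g by measurable
  define \<A>\<^sub>0 where "\<A>\<^sub>0 = {B, space M - B} - {{}}"
  have A0: "\<A>\<^sub>0 \<in> ?PP"
    using B sets.sets_into_space[OF B(1)]
    by (auto simp: \<A>\<^sub>0_def partition_on_def disjoint_def)
  have "(LINT x:A|M. \<bar>?h x\<bar>) = \<bar>measure (density M f) A - measure (density M g) A\<bar>"
    if "A \<in> \<A>\<^sub>0" for A
  proof -
    have A: "A \<in> sets M" using A0 that by auto
    have "A = B \<or> A = space M - B"
      using that by (auto simp: \<A>\<^sub>0_def)
    then have "(\<forall>x\<in>A. \<bar>?h x\<bar> = ?h x) \<or> (\<forall>x\<in>A. \<bar>?h x\<bar> = - ?h x)"
      by (elim disjE) (auto simp: B_def)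
    then have "(LINT x:A|M. \<bar>?h x\<bar>) = (LINT x:A|M. ?h x) \<or>
        (LINT x:A|M. \<bar>?h x\<bar>) = (LINT x:A|M. - ?h x)"
    proof
      assume "\<forall>x\<in>A. \<bar>?h x\<bar> = ?h x"
      then have "(LINT x:A|M. \<bar>?h x\<bar>) = (LINT x:A|M. ?h x)"
        by (intro set_lebesgue_integral_cong[OF A]) blast
      then show ?thesis ..
    next
      assume "\<forall>x\<in>A. \<bar>?h x\<bar> = - ?h x"
      then have "(LINT x:A|M. \<bar>?h x\<bar>) = (LINT x:A|M. - ?h x)"
        by (intro set_lebesgue_integral_cong[OF A]) blast
      then show ?thesis ..
    qed
    moreover have "0 \<le> (LINT x:A|M. \<bar>?h x\<bar>)"
      by (auto simp: set_lebesgue_integral_def intro!: Bochner_Integration.integral_nonneg)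
    moreover have "(LINT x:A|M. - ?h x) = - (LINT x:A|M. ?h x)"
      using si[OF h(1) A] by (rule set_integral_uminus)
    ultimately show ?thesis
      unfolding diff[OF A] by linarith
  qed
  then have attained: "(\<Sum>A\<in>\<A>\<^sub>0. \<bar>measure (density M f) A - measure (density M g) A\<bar>) = ?I"
    using parts[OF A0] by simp
  have "(\<Squnion>\<A>\<in>?PP. \<Sum>A\<in>\<A>. \<bar>measure (density M f) A - measure (density M g) A\<bar>) = ?I"
  proof (rule cSup_eq_maximum)
    show "?I \<in> (\<lambda>\<A>. \<Sum>A\<in>\<A>. \<bar>measure (density M f) A - measure (density M g) A\<bar>) ` ?PP"
      by (rule image_eqI[where x = "\<A>\<^sub>0"]) (rule attained[symmetric], rule A0)
  next
    fix c
    assume "c \<in> (\<lambda>\<A>. \<Sum>A\<in>\<A>. \<bar>measure (density M f) A - measure (density M g) A\<bar>) ` ?PP"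
    then show "c \<le> ?I"
      by (elim imageE) (simp only: upper)
  qed
  then show ?thesis
    by (simp only: tv_norm_diff_def space_density sets_density)
qed

definition Delta ::
  "nat \<Rightarrow> 'a measure \<Rightarrow> 'b measure \<Rightarrow> ('a \<Rightarrow> 'b) \<Rightarrow> ('a \<Rightarrow> nat) \<Rightarrow> real" where
  "Delta k P S X Y =
    (\<Sum>(y, z)\<in>{(y, z). 1 \<le> y \<and> y < z \<and> z \<le> k}.
       tv_norm_diff (class_measure P S X Y y) (class_measure P S X Y z))"

definition L_bound :: "nat \<Rightarrow> real \<Rightarrow> real" where
  "L_bound k \<Delta> = 1 - (1 + \<Delta>) / real k"

definition U_bound :: "nat \<Rightarrow> real \<Rightarrow> real" where
  "U_bound k \<Delta> =
    1 - (real k + 1 + \<Delta> - 2 * of_int \<lceil>\<Delta>\<rceil>) /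
        ((real k - of_int \<lceil>\<Delta>\<rceil>) * (real k + 1 - of_int \<lceil>\<Delta>\<rceil>))"

definition U_simpl :: "nat \<Rightarrow> real \<Rightarrow> real" where
  "U_simpl k \<Delta> = 1 - 1 / (real k - \<Delta>)"


section \<open>Conditional entropy and the bounds in terms of \<open>H\<close>\<close>

text \<open>Both here and in \<open>h2\<close> the convention \<open>0 ln 0 = 0\<close> holds automatically.\<close>

definition cond_entropy ::
  "nat \<Rightarrow> 'a measure \<Rightarrow> 'b measure \<Rightarrow> ('a \<Rightarrow> 'b) \<Rightarrow> (nat \<Rightarrow> 'b \<Rightarrow> real) \<Rightarrow> real" where
  "cond_entropy k P S X \<rho> = - (\<integral>x. (\<Sum>y\<in>{1..k}. \<rho> y x * ln (\<rho> y x)) \<partial>distr P S X)"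

definition h2 :: "real \<Rightarrow> real" where
  "h2 p = - p * ln p - (1 - p) * ln (1 - p)"

definition Phi :: "nat \<Rightarrow> real \<Rightarrow> real" where
  "Phi k p = p * ln (real k - 1) + h2 p"

definition L_FM :: "nat \<Rightarrow> real \<Rightarrow> real" where
  "L_FM k H = inv_into {0..1 - 1 / real k} (Phi k) H"

definition e_FM :: "real \<Rightarrow> real" where
  "e_FM H = of_int (\<lceil>exp H\<rceil> - 1)"

text \<open>Meaningful only for \<open>H > 0\<close>, since \<open>e_FM 0 = 0\<close>.\<close>

definition U_FM :: "real \<Rightarrow> real" where
  "U_FM H =
    (e_FM H - 1) / e_FM H +
    1 / (e_FM H * (e_FM H + 1)) * ((H - ln (e_FM H)) / ln (1 + 1 / e_FM H))"

end

theory Submission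
  imports Defs "HOL-Real_Asymp.Real_Asymp"
begin

text \<open>
  In a pure setting with two classes the pair of densities at any point is \<open>(p, 1 - p)\<close> or
  \<open>(1 - p, p)\<close>, where \<open>p \<le> 1/2\<close> is the smaller of the two weights.  Each of \<open>\<Delta>\<close>, \<open>H\<close> and \<open>p\<^sub>*\<close>
  is the integral against the probability measure \<open>\<mu>\<close> of a symmetric function of this pair, hence an
  integral of a constant: \<open>\<Delta> = 1 - 2 p\<close>, \<open>H = h2 p\<close>, and the optimal classifier errs with
  probability \<open>p\<close>, since at each point it discards exactly the smaller density.  The equalities then
  reduce to \<open>1 - (1 + \<Delta>) / 2 = p\<close> and to the injectivity of the binary entropy on \<open>[0, 1/2]\<close>.

  The exceptional case of the second part contains \<open>p = 0\<close> and \<open>p = 1/2\<close> (take the empty set for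
  \<open>S\<^sub>0\<close>), so the strict inequalities are needed only for \<open>0 < p < 1/2\<close>.  There \<open>0 < H < ln 2\<close>, which
  forces \<open>e(H) = 1\<close> and \<open>U\<^sub>F\<^sub>M(H) = H / (2 ln 2)\<close>, whereas \<open>U\<^sub>s\<^sub>i\<^sub>m\<^sub>p\<^sub>l(\<Delta>) = 2 p / (1 + 2 p)\<close>.  The second
  number visibly exceeds \<open>p\<close>.  The first exceeds the second because \<open>h2 p - 4 ln 2 p / (1 + 2 p)\<close>
  vanishes at both ends of \<open>[0, 1/2]\<close> and is strictly concave in between
  (\<open>h2_gt_scaled_U_simpl\<close>).
\<close>

section \<open>Binary entropy\<close>

lemma continuous_on_x_ln_x: "continuous_on {0..} (\<lambda>x::real. x * ln x)"
proof -
  have "continuous (at x within {0..}) (\<lambda>x::real. x * ln x)" if "x \<ge> 0" for x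
  proof (cases "x = 0")
    case True
    have "((\<lambda>x::real. x * ln x) \<longlongrightarrow> 0) (at_right 0)"
      by real_asymp
    then show ?thesis
      using True by (simp add: continuous_within at_within_Ici_at_right)
  next
    case False
    then show ?thesis
      by (intro continuous_intros) auto
  qed
  then show ?thesis
    by (simp add: continuous_on_eq_continuous_within)
qed

lemma continuous_on_h2: "continuous_on {0..1} h2"
proof -
  have "continuous_on {0..1} (\<lambda>x::real. - (x * ln x) - (1 - x) * ln (1 - x))"
    by (intro continuous_on_diff continuous_on_minus
        continuous_on_subset[OF continuous_on_x_ln_x]
        continuous_on_compose2[OF continuous_on_x_ln_x, of _ "\<lambda>x. 1 - x"] continuous_intros) auto
  then show ?thesis
    by (simp add: h2_def[abs_def])
qed

lemma DERIV_h2: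
  assumes "0 < x" "x < 1"
  shows "DERIV h2 x :> ln (1 - x) - ln x"
  unfolding h2_def[abs_def] using assms
  by (auto intro!: derivative_eq_intros)

lemma h2_strict_mono_on: "strict_mono_on {0..1/2} h2"
proof (rule strict_mono_onI)
  fix x y :: real
  assume xy: "x \<in> {0..1/2}" "y \<in> {0..1/2}" "x < y"
  show "h2 x < h2 y"
  proof (rule DERIV_pos_imp_increasing_open[OF xy(3)])
    fix z
    assume "x < z" "z < y"
    then show "\<exists>d. DERIV h2 z :> d \<and> d > 0"
      using xy by (intro exI[of _ "ln (1 - z) - ln z"] conjI DERIV_h2) auto
  next
    show "continuous_on {x..y} h2"
      by (rule continuous_on_subset[OF continuous_on_h2]) (use xy in auto)
  qed
qed

lemma h2_0: "h2 0 = 0"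
  by (simp add: h2_def)

lemma h2_half: "h2 (1/2) = ln 2"
  by (simp add: h2_def ln_div)

text \<open>
  A strictly concave function lies above its chords; in particular it is positive between two
  zeros.  Concavity enters through the strictly decreasing derivative, so that nothing is required
  of the derivative at the end points: that of \<^const>\<open>h2\<close> tends to infinity at 0.
\<close>

lemma pos_between_zeros_if_DERIV_decreasing:
  fixes f f' :: "real \<Rightarrow> real"
  assumes cont: "continuous_on {a..b} f" and zeros: "f a = 0" "f b = 0"
    and der: "\<And>x. a < x \<Longrightarrow> x < b \<Longrightarrow> DERIV f x :> f' x"
    and decr: "\<And>x y. a < x \<Longrightarrow> x < y \<Longrightarrow> y < b \<Longrightarrow> f' y < f' x"
    and x: "a < x" "x < b"
  shows "0 < f x"
proof -
  have "\<exists>l z. a < z \<and> z < x \<and> DERIV f z :> l \<and> f x - f a = (x - a) * l"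
    using x der
    by (intro MVT continuous_on_subset[OF cont])
      (auto simp: real_differentiable_def, meson less_trans)
  then obtain l z where z: "a < z" "z < x" "DERIV f z :> l" "f x - f a = (x - a) * l"
    by blast
  have "\<exists>m w. x < w \<and> w < b \<and> DERIV f w :> m \<and> f b - f x = (b - x) * m"
    using x der
    by (intro MVT continuous_on_subset[OF cont])
      (auto simp: real_differentiable_def, meson less_trans)
  then obtain m w where w: "x < w" "w < b" "DERIV f w :> m" "f b - f x = (b - x) * m"
    by blast
  have "l = f' z" "m = f' w"
    using DERIV_unique[OF z(3) der] DERIV_unique[OF w(3) der] z w x by auto
  then have less: "m < l"
    using decr[of z w] z w by auto
  show ?thesis
  proof (rule ccontr)
    assume "\<not> 0 < f x"
    then have "(x - a) * l \<le> 0" "(b - x) * m \<ge> 0"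
      using z(4) w(4) zeros by auto
    then have "l \<le> 0" "m \<ge> 0"
      using x by (auto simp: mult_le_0_iff zero_le_mult_iff)
    with less show False by simp
  qed
qed

text \<open>
  The difference of the two sides has second derivative \<open>16 ln 2 / (1 + 2 x)\<^sup>3 - 1 / (x (1 - x))\<close>.
  Already \<open>ln 2 < 1\<close> makes it negative, because
  \<open>(1 + 2 x)\<^sup>3 - 16 x (1 - x) = (28 x\<^sup>2 - 10 x + 1) + 8 x\<^sup>3\<close>, where the quadratic has negative
  discriminant.
\<close>

lemma h2_gt_scaled_U_simpl:
  assumes p: "0 < p" "p < 1/2"
  shows "4 * ln 2 * p / (1 + 2 * p) < h2 p"
proof -
  define f where "f = (\<lambda>x. h2 x - 4 * ln 2 * x / (1 + 2 * x))"
  define f' where "f' = (\<lambda>x::real. ln (1 - x) - ln x - 4 * ln 2 / (1 + 2 * x)^2)"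
  have "0 < f p"
  proof (rule pos_between_zeros_if_DERIV_decreasing[of 0 "1/2" f f'])
    show "continuous_on {0..1/2} f"
      unfolding f_def
      by (intro continuous_intros continuous_on_subset[OF continuous_on_h2]) auto
    show "f 0 = 0" "f (1/2) = 0"
      using h2_half by (simp_all add: f_def h2_0)
    show "DERIV f x :> f' x" if "0 < x" "x < 1/2" for x
      unfolding f_def f'_def using that
      by (auto intro!: derivative_eq_intros DERIV_h2 simp: field_simps power2_eq_square)
    show "f' y < f' x" if xy: "0 < x" "x < y" "y < 1/2" for x y
    proof (rule DERIV_neg_imp_decreasing[OF xy(2)])
      fix z
      assume "x \<le> z" "z \<le> y"
      with xy have z: "0 < z" "z < 1/2" by auto
      have "28 * z^2 - 10 * z + 1 = 28 * (z - 5/28)^2 + 3/28"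
        by (simp add: power2_eq_square algebra_simps)
      also have "\<dots> > 0"
        by (intro add_nonneg_pos) auto
      finally have "0 < (28 * z^2 - 10 * z + 1) + 8 * z^3"
        by (rule add_pos_pos) (use z in auto)
      also have "\<dots> = (1 + 2 * z)^3 - 16 * (z * (1 - z))"
        by (simp add: power3_eq_cube power2_eq_square algebra_simps)
      finally have "16 * (z * (1 - z)) < (1 + 2 * z)^3" by simp
      moreover have "ln 2 * (16 * (z * (1 - z))) \<le> 1 * (16 * (z * (1 - z)))"
        using z ln_le_minus_one[of 2] by (intro mult_right_mono) auto
      ultimately have "16 * ln 2 * (z * (1 - z)) < (1 + 2 * z)^3"
        by (simp add: algebra_simps)
      then have "16 * ln 2 / (1 + 2 * z)^3 < 1 / (z * (1 - z))"
        using z by (simp add: divide_simps)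
      moreover have "DERIV f' z :> 16 * ln 2 / (1 + 2 * z)^3 - 1 / (z * (1 - z))"
      proof -
        have nz: "1 + 2 * z \<noteq> 0"
          using z by simp
        have cancel: "- (4 * ln 2 * (2 * u * 2)) / (u^2 * u^2) = - (16 * ln 2 / u^3)"
          if "u \<noteq> 0" for u :: real
          using that by (simp add: field_simps power2_eq_square power3_eq_cube)
        have "DERIV (\<lambda>x. 4 * ln 2 / (1 + 2 * x)^2) z :>
            - (4 * ln 2 * (2 * (1 + 2 * z) * 2)) / ((1 + 2 * z)^2 * (1 + 2 * z)^2)"
          using nz by (auto intro!: derivative_eq_intros)
        also have "- (4 * ln 2 * (2 * (1 + 2 * z) * 2)) / ((1 + 2 * z)^2 * (1 + 2 * z)^2)
            = - (16 * ln 2 / (1 + 2 * z)^3)"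
          by (rule cancel[OF nz])
        finally have "DERIV (\<lambda>x. 4 * ln 2 / (1 + 2 * x)^2) z :> - (16 * ln 2 / (1 + 2 * z)^3)" .
        moreover have "DERIV (\<lambda>x. ln (1 - x) - ln x) z :> - (1 / (1 - z)) - 1 / z"
          using z by (auto intro!: derivative_eq_intros)
        ultimately have "DERIV f' z :> (- (1 / (1 - z)) - 1 / z) - (- (16 * ln 2 / (1 + 2 * z)^3))"
          unfolding f'_def by (rule DERIV_diff[rotated])
        moreover have "- (1 / (1 - z)) - 1 / z = - (1 / (z * (1 - z)))"
          using z by (simp add: field_simps)
        ultimately show ?thesis by (simp add: algebra_simps)
      qed
      ultimately show "\<exists>d. DERIV f' z :> d \<and> d < 0"
        by (intro exI[of _ "16 * ln 2 / (1 + 2 * z)^3 - 1 / (z * (1 - z))"]) auto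
    qed
  qed (use p in auto)
  then show ?thesis by (simp add: f_def)
qed


section \<open>The bounds for two classes\<close>

text \<open>
  For \<open>\<Delta> > 0\<close> the ceiling is 1; at \<open>\<Delta> = 0\<close> the ceiling drops to 0, and the formulas still agree.
\<close>

lemma U_bound_2_eq_L_bound_2:
  assumes "0 \<le> \<Delta>" "\<Delta> \<le> 1"
  shows "U_bound 2 \<Delta> = L_bound 2 \<Delta>"
proof (cases "\<Delta> = 0")
  case False
  then have "\<lceil>\<Delta>\<rceil> = 1"
    using assms by (simp add: ceiling_eq_iff)
  then show ?thesis
    by (simp add: U_bound_def L_bound_def)
qed (simp add: U_bound_def L_bound_def)

lemma L_FM_2_h2:
  assumes "0 \<le> p" "p \<le> 1/2"
  shows "L_FM 2 (h2 p) = p"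
proof -
  have "Phi 2 = h2"
    by (simp add: Phi_def fun_eq_iff)
  then show ?thesis
    using inv_into_f_f[OF strict_mono_on_imp_inj_on[OF h2_strict_mono_on], of p] assms
    by (simp add: L_FM_def)
qed

lemma U_FM_h2:
  assumes p: "0 < p" "p < 1/2"
  shows "U_FM (h2 p) = h2 p / (2 * ln 2)"
proof -
  have "0 < h2 p" "h2 p < ln 2"
    using strict_mono_onD[OF h2_strict_mono_on, of 0 p]
      strict_mono_onD[OF h2_strict_mono_on, of p "1/2"] p h2_0 h2_half by auto
  then have "1 < exp (h2 p)" "exp (h2 p) < 2"
    by (auto simp flip: ln_gt_zero_iff) (metis exp_less_mono exp_ln zero_less_numeral)
  then have "\<lceil>exp (h2 p)\<rceil> = 2"
    by (simp add: ceiling_eq_iff)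
  then show ?thesis
    by (simp add: U_FM_def e_FM_def)
qed

lemma U_simpl_strictly_between:
  assumes p: "0 < p" "p < 1/2"
  shows "p < U_simpl 2 (1 - 2 * p)" "U_simpl 2 (1 - 2 * p) < U_FM (h2 p)"
proof -
  have U: "U_simpl 2 (1 - 2 * p) = 2 * p / (1 + 2 * p)"
    using p by (simp add: U_simpl_def field_simps)
  have "p * (1 + 2 * p) < p * 2"
    using p by (intro mult_strict_left_mono) auto
  then have "p < 2 * p / (1 + 2 * p)"
    using p by (simp add: less_divide_eq mult.commute)
  then show "p < U_simpl 2 (1 - 2 * p)"
    by (simp only: U)
  have "2 * p / (1 + 2 * p) = (4 * ln 2 * p / (1 + 2 * p)) / (2 * ln 2)"
    using p by (simp add: divide_simps)
  also have "\<dots> < h2 p / (2 * ln 2)"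
    by (intro divide_strict_right_mono h2_gt_scaled_U_simpl p) simp
  finally show "U_simpl 2 (1 - 2 * p) < U_FM (h2 p)"
    using p by (simp add: U U_FM_h2)
qed


section \<open>Two classes in a pure setting\<close>

lemma pure_setting_2_obtains:
  assumes "pure_setting 2 S \<rho>"
  obtains p where "0 \<le> p" "p \<le> 1/2"
    "\<And>x. x \<in> space S \<Longrightarrow>
      (\<rho> 1 x = p \<and> \<rho> 2 x = 1 - p) \<or> (\<rho> 1 x = 1 - p \<and> \<rho> 2 x = p)"
proof -
  have two: "{1..2} = {1, 2::nat}" by auto
  obtain a :: "nat \<Rightarrow> real" where a: "0 \<le> a 1" "0 \<le> a 2" "a 1 + a 2 = 1"
    and perm: "\<And>x. x \<in> space S \<Longrightarrow>
      \<exists>\<pi>. \<pi> permutes {1, 2} \<and> \<rho> 1 x = a (\<pi> 1) \<and> \<rho> 2 x = a (\<pi> 2)"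
    using assms unfolding pure_setting_def two by auto
  show thesis
  proof (rule that[of "min (a 1) (a 2)"])
    fix x
    assume "x \<in> space S"
    then obtain \<pi> where \<pi>: "\<pi> permutes {1, 2::nat}" "\<rho> 1 x = a (\<pi> 1)" "\<rho> 2 x = a (\<pi> 2)"
      using perm by blast
    have "\<pi> 1 \<in> {1, 2}" "\<pi> 2 \<in> {1, 2}" "\<pi> 1 \<noteq> \<pi> 2"
      using permutes_in_image[OF \<pi>(1), of 1] permutes_in_image[OF \<pi>(1), of 2]
        inj_eq[OF permutes_inj[OF \<pi>(1)], of 1 2] by auto
    then have "(\<rho> 1 x = a 1 \<and> \<rho> 2 x = a 2) \<or> (\<rho> 1 x = a 2 \<and> \<rho> 2 x = a 1)"
      using \<pi>(2,3) by auto
    then show "(\<rho> 1 x = min (a 1) (a 2) \<and> \<rho> 2 x = 1 - min (a 1) (a 2)) \<or>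
        (\<rho> 1 x = 1 - min (a 1) (a 2) \<and> \<rho> 2 x = min (a 1) (a 2))"
      using a by (auto simp: min_def)
  qed (use a in auto)
qed

lemma f_star_2: "f_star 2 \<rho> x = (if \<rho> 2 x \<le> \<rho> 1 x then 1 else 2)"
proof -
  have two: "{1..2} = {1, 2::nat}" by auto
  show ?thesis
    unfolding f_star_def two by (rule Least_equality) (auto split: if_splits)
qed

text \<open>Where the density of a class is constant, joint probabilities with that class factorise.\<close>

lemma prob_class_const_density:
  assumes "prob_space P" and X: "X \<in> P \<rightarrow>\<^sub>M S" and Y: "Y \<in> P \<rightarrow>\<^sub>M count_space {1..k}"
    and \<rho>: "class_densities k P S X Y \<rho>" and y: "y \<in> {1..k}" and B: "B \<in> sets S"
    and const: "\<And>x. x \<in> B \<Longrightarrow> \<rho> y x = c" and c: "0 \<le> c"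
  shows "measure P {\<omega> \<in> space P. Y \<omega> = y \<and> X \<omega> \<in> B} = c * measure (distr P S X) B"
proof -
  interpret prob_space P by fact
  interpret \<mu>: prob_space "distr P S X" by (rule prob_space_distr[OF X])
  have "emeasure P {\<omega> \<in> space P. Y \<omega> = y \<and> X \<omega> \<in> B}
      = emeasure (density (distr P S X) (\<lambda>x. ennreal (\<rho> y x))) B"
    using \<rho> y emeasure_class_measure[OF X Y B, of y] by (simp add: class_densities_def)
  also have "\<dots> = (\<integral>\<^sup>+x. ennreal (\<rho> y x) * indicator B x \<partial>distr P S X)"
    using \<rho> y B by (intro emeasure_density) (auto simp: class_densities_def)
  also have "\<dots> = (\<integral>\<^sup>+x. ennreal c * indicator B x \<partial>distr P S X)"
    using const by (intro nn_integral_cong) (auto simp: indicator_def)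
  also have "\<dots> = ennreal c * emeasure (distr P S X) B"
    using B by (intro nn_integral_cmult_indicator) auto
  also have "\<dots> = ennreal (c * measure (distr P S X) B)"
    using c by (simp add: \<mu>.emeasure_eq_measure ennreal_mult)
  finally show ?thesis
    using c by (simp add: emeasure_eq_measure)
qed

text \<open>
  The conclusion of \<open>pure_setting_2_obtains\<close>, with \<open>p\<close> as a parameter: in this form each of
  \<open>\<Delta>\<close>, \<open>H\<close> and \<open>p\<^sub>*\<close> becomes an explicit function of \<open>p\<close>.
\<close>

locale two_class_pure = prob_space P
  for P :: "'a measure" and S :: "'b measure" and X :: "'a \<Rightarrow> 'b" and Y :: "'a \<Rightarrow> nat"
    and \<rho> :: "nat \<Rightarrow> 'b \<Rightarrow> real" and p :: real +
  assumes X: "X \<in> P \<rightarrow>\<^sub>M S" and Y: "Y \<in> P \<rightarrow>\<^sub>M count_space {1..2}"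
    and densities: "class_densities 2 P S X Y \<rho>"
    and p: "0 \<le> p" "p \<le> 1/2"
    and pure: "\<And>x. x \<in> space S \<Longrightarrow>
      (\<rho> 1 x = p \<and> \<rho> 2 x = 1 - p) \<or> (\<rho> 1 x = 1 - p \<and> \<rho> 2 x = p)"
begin

sublocale \<mu>: prob_space "distr P S X"
  by (rule prob_space_distr[OF X])

lemma densities_measurable: "\<rho> 1 \<in> borel_measurable S" "\<rho> 2 \<in> borel_measurable S"
  using densities by (auto simp: class_densities_def)

lemma integral_distr_const:
  fixes g :: "'b \<Rightarrow> real"
  assumes "\<And>x. x \<in> space S \<Longrightarrow> g x = c"
  shows "(\<integral>x. g x \<partial>distr P S X) = c"
proof -
  have "(\<integral>x. g x \<partial>distr P S X) = (\<integral>x. c \<partial>distr P S X)"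
    using assms by (intro Bochner_Integration.integral_cong) auto
  then show ?thesis using \<mu>.prob_space by simp
qed

lemma Delta_eq: "Delta 2 P S X Y = 1 - 2 * p"
proof -
  have "{(y, z). 1 \<le> y \<and> y < z \<and> z \<le> (2::nat)} = {(1, 2)}" by auto
  then have "Delta 2 P S X Y =
      tv_norm_diff (density (distr P S X) (\<rho> 1)) (density (distr P S X) (\<rho> 2))"
    using densities by (simp add: Delta_def class_densities_def)
  also have "\<dots> = (\<integral>x. \<bar>\<rho> 1 x - \<rho> 2 x\<bar> \<partial>distr P S X)"
  proof (rule tv_norm_diff_density)
    show "integrable (distr P S X) (\<rho> 1)" "integrable (distr P S X) (\<rho> 2)"
      using pure p densities_measurable
      by (auto intro!: \<mu>.integrable_const_bound[where B = 1] AE_I2 dest!: pure)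
  qed (use pure p in \<open>force+\<close>)
  also have "\<dots> = 1 - 2 * p"
    by (rule integral_distr_const) (use pure p in force)
  finally show ?thesis .
qed

lemma cond_entropy_eq: "cond_entropy 2 P S X \<rho> = h2 p"
proof -
  have two: "{1..2} = {1, 2::nat}" by auto
  have "(\<integral>x. (\<Sum>y\<in>{1..2}. \<rho> y x * ln (\<rho> y x)) \<partial>distr P S X) = - h2 p"
    unfolding two by (rule integral_distr_const) (use pure in \<open>force simp: h2_def\<close>)
  then show ?thesis
    by (simp add: cond_entropy_def)
qed

text \<open>
  The classifier errs on \<open>{\<rho> 1 < \<rho> 2}\<close> exactly when the class is 1, and off it exactly when the
  class is 2; on either set the missed class has constant density \<open>p\<close>.
\<close>

lemma p_star_eq: "p_star 2 P X Y \<rho> = p"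
proof -
  define B where "B = {x \<in> space S. \<rho> 1 x < \<rho> 2 x}"
  have B: "B \<in> sets S"
    unfolding B_def using densities_measurable by measurable
  let ?E = "\<lambda>y B. {\<omega> \<in> space P. Y \<omega> = y \<and> X \<omega> \<in> B}"
  have E: "?E y A \<in> sets P" if "A \<in> sets S" for y A
  proof -
    have "(Y -` ({y} \<inter> {1..2}) \<inter> space P) \<inter> (X -` A \<inter> space P) \<in> sets P"
      by (rule sets.Int[OF measurable_sets[OF Y] measurable_sets[OF X that]]) simp
    also have "(Y -` ({y} \<inter> {1..2}) \<inter> space P) \<inter> (X -` A \<inter> space P) = ?E y A"
      using measurable_space[OF Y] by auto
    finally show ?thesis .
  qed
  have misclassified: "f_star 2 \<rho> (X \<omega>) \<noteq> Y \<omega> \<longleftrightarrow>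
      (Y \<omega> = 1 \<and> X \<omega> \<in> B) \<or> (Y \<omega> = 2 \<and> X \<omega> \<in> space S - B)"
    if "\<omega> \<in> space P" for \<omega>
  proof -
    have "Y \<omega> = 1 \<or> Y \<omega> = 2" and X\<omega>: "X \<omega> \<in> space S"
      using measurable_space[OF Y that] measurable_space[OF X that] by auto
    from this(1) show ?thesis
    proof
      assume "Y \<omega> = 1"
      with X\<omega> show ?thesis by (simp add: f_star_2 B_def not_le)
    next
      assume "Y \<omega> = 2"
      with X\<omega> show ?thesis by (simp add: f_star_2 B_def not_less)
    qed
  qed
  have "p_star 2 P X Y \<rho> = measure P (?E 1 B \<union> ?E 2 (space S - B))"
    unfolding p_star_def misclass_prob_def
    by (rule arg_cong[where f = "measure P"]) (use misclassified in blast)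
  also have "\<dots> = measure P (?E 1 B) + measure P (?E 2 (space S - B))"
    by (rule finite_measure_Union) (use E[OF B] E[OF sets.Diff[OF sets.top B]] in auto)
  also have "measure P (?E 1 B) = p * measure (distr P S X) B"
  proof (rule prob_class_const_density[OF prob_space_axioms X Y densities _ B _ p(1)])
    show "\<rho> 1 x = p" if "x \<in> B" for x
      using that pure[of x] p by (auto simp: B_def)
  qed simp
  also have "measure P (?E 2 (space S - B)) = p * measure (distr P S X) (space S - B)"
  proof (rule prob_class_const_density[OF prob_space_axioms X Y densities _ _ _ p(1)])
    show "\<rho> 2 x = p" if "x \<in> space S - B" for x
      using that pure[of x] p by (auto simp: B_def)
  qed (use B in auto)
  also have "measure (distr P S X) (space S - B) = 1 - measure (distr P S X) B"
    using \<mu>.prob_compl[of B] B by simp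
  finally show ?thesis
    by (simp add: algebra_simps)
qed

end

theorem proposition9:
  fixes P :: "'a measure" and S :: "'b measure"
    and X :: "'a \<Rightarrow> 'b" and Y :: "'a \<Rightarrow> nat" and \<rho> :: "nat \<Rightarrow> 'b \<Rightarrow> real"
  assumes "prob_space P"
    and "X \<in> P \<rightarrow>\<^sub>M S"
    and "Y \<in> P \<rightarrow>\<^sub>M count_space {1..2}"
    and "class_densities 2 P S X Y \<rho>"
    and "pure_setting 2 S \<rho>"
  shows "let \<mu> = distr P S X; \<Delta> = Delta 2 P S X Y; H = cond_entropy 2 P S X \<rho>;
             pstar = p_star 2 P X Y \<rho>
    in U_bound 2 \<Delta> = L_bound 2 \<Delta> \<and> L_bound 2 \<Delta> = L_FM 2 H \<and> L_FM 2 H = pstar \<and>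
       (\<not> (\<exists>S\<^sub>0\<in>sets S. emeasure \<mu> S\<^sub>0 = 0 \<and>
              (\<forall>x\<in>space S - S\<^sub>0. (\<rho> 1 x = 1/2 \<and> \<rho> 2 x = 1/2) \<or> {\<rho> 1 x, \<rho> 2 x} = {0, 1})) \<longrightarrow>
        U_FM H > U_simpl 2 \<Delta> \<and> U_simpl 2 \<Delta> > pstar)"
proof -
  obtain p where p: "0 \<le> p" "p \<le> 1/2"
    and pure: "\<And>x. x \<in> space S \<Longrightarrow>
      (\<rho> 1 x = p \<and> \<rho> 2 x = 1 - p) \<or> (\<rho> 1 x = 1 - p \<and> \<rho> 2 x = p)"
    using pure_setting_2_obtains[OF assms(5)] by blast
  interpret prob_space P by fact
  interpret two_class_pure P S X Y \<rho> p
    by unfold_locales (use assms p pure in auto)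
  have eqs: "U_bound 2 (1 - 2 * p) = L_bound 2 (1 - 2 * p)" "L_bound 2 (1 - 2 * p) = L_FM 2 (h2 p)"
      "L_FM 2 (h2 p) = p"
    using p by (simp_all add: U_bound_2_eq_L_bound_2 L_FM_2_h2) (simp add: L_bound_def field_simps)
  have strict: "U_FM (h2 p) > U_simpl 2 (1 - 2 * p) \<and> U_simpl 2 (1 - 2 * p) > p"
    if nontrivial: "\<not> (\<exists>S\<^sub>0\<in>sets S. emeasure (distr P S X) S\<^sub>0 = 0 \<and>
      (\<forall>x\<in>space S - S\<^sub>0. (\<rho> 1 x = 1/2 \<and> \<rho> 2 x = 1/2) \<or> {\<rho> 1 x, \<rho> 2 x} = {0, 1}))"
  proof -
    \<comment> \<open>For these two values the empty set is an admissible exceptional set.\<close>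
    have "p \<noteq> 0 \<and> p \<noteq> 1/2"
    proof (rule ccontr)
      assume "\<not> ?thesis"
      then have "\<forall>x\<in>space S - {}. (\<rho> 1 x = 1/2 \<and> \<rho> 2 x = 1/2) \<or> {\<rho> 1 x, \<rho> 2 x} = {0, 1}"
        using pure by fastforce
      with nontrivial show False
        by (metis emeasure_empty sets.empty_sets)
    qed
    with p have "0 < p" "p < 1/2" by auto
    then show ?thesis
      using U_simpl_strictly_between by blast
  qed
  show ?thesis
    unfolding Let_def Delta_eq cond_entropy_eq p_star_eq
    by (intro conjI impI eqs strict[THEN conjunct1] strict[THEN conjunct2])
qed

end
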